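(* Let $m,n$ be integers with $m,n\ge 5$ and $|n-m|\ge 2$. Then $$f\big(M(C_{2n})\times M(C_{2m})\big)\le f\big(M(C_{2n})\big)\,f\big(M(C_{2m})\big).$$
   Context: A distribution of pebbles on a graph assigns a nonnegative integer number of pebbles to each vertex. A pebbling move removes two pebbles from a vertex and places one pebble on an adjacent vertex. For a connected graph $G$ and a vertex $v$, $f(G,v)$ is the smallest integer $N$ such that from every distribution of $N$ pebbles on $G$ one pebble can be moved to $v$ by a sequence of pebbling moves; the pebbling number is $f(G)=\max_{v\in V(G)} f(G,v)$. $C_k$ denotes the cycle on $k$ vertices. The middle graph $M(G)$ of a graph $G$ is obtained from $G$ by inserting a new vertex into each edge of $G$ (subdividing it), and joining two new vertices by an edge whenever the two edges of $G$ they were inserted into share a common endpoint. For graphs $G_1,G_2$, the Cartesian product $G_1\times G_2$ has vertex set $V(G_1)\times V(G_2)$, with $(u_1,v_1)$ adjacent to $(u_2,v_2)$ iff either $u_1=u_2$ and $v_1v_2\in E(G_2)$, or $u_1u_2\in E(G_1)$ and $v_1=v_2$. *)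

theory Defs
  imports "Graph_Theory.Graph_Theory"
begin

text \<open>
  Simple undirected graphs are represented by the locale \<^locale>\<open>pair_graph\<close>: an edge
  \<open>uv\<close> is the pair of arcs \<open>(u, v)\<close>, \<open>(v, u)\<close>.
\<close>

definition edge_set :: "'a pair_pre_digraph \<Rightarrow> 'a set set" where
  "edge_set G = {{u, v} | u v. (u, v) \<in> parcs G}"

text \<open>This is a cycle in the usual sense only for \<open>k \<ge> 3\<close>.\<close>

definition cycle_graph :: "nat \<Rightarrow> nat pair_pre_digraph" where
  "cycle_graph k =
     \<lparr> pverts = {0..<k},
       parcs = {(i, j). i < k \<and> j < k \<and> (j = (i + 1) mod k \<or> i = (j + 1) mod k)} \<rparr>"

text \<open>
  \<open>Inl v\<close> is the original vertex \<open>v\<close>, \<open>Inr e\<close> the new vertex inserted into the edge \<open>e\<close>.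
  Since every edge of \<open>G\<close> is subdivided, no two original vertices are adjacent.
\<close>

definition middle_graph :: "'a pair_pre_digraph \<Rightarrow> ('a + 'a set) pair_pre_digraph" where
  "middle_graph G =
     \<lparr> pverts = Inl ` pverts G \<union> Inr ` edge_set G,
       parcs = {(Inl v, Inr e) | v e. e \<in> edge_set G \<and> v \<in> e}
             \<union> {(Inr e, Inl v) | v e. e \<in> edge_set G \<and> v \<in> e}
             \<union> {(Inr e, Inr e') | e e'. e \<in> edge_set G \<and> e' \<in> edge_set G \<and>
                                       e \<noteq> e' \<and> e \<inter> e' \<noteq> {}} \<rparr>"

definition cartesian_product ::
    "'a pair_pre_digraph \<Rightarrow> 'b pair_pre_digraph \<Rightarrow> ('a \<times> 'b) pair_pre_digraph" where
  "cartesian_product G H =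
     \<lparr> pverts = pverts G \<times> pverts H,
       parcs = {((u1, v1), (u2, v2)) | u1 v1 u2 v2.
                  u1 = u2 \<and> u1 \<in> pverts G \<and> (v1, v2) \<in> parcs H \<or>
                  (u1, u2) \<in> parcs G \<and> v1 = v2 \<and> v1 \<in> pverts H} \<rparr>"

definition distributions :: "'a pair_pre_digraph \<Rightarrow> nat \<Rightarrow> ('a \<Rightarrow> nat) set" where
  "distributions G N = {D. (\<forall>x. x \<notin> pverts G \<longrightarrow> D x = 0) \<and> (\<Sum>x\<in>pverts G. D x) = N}"

inductive pebbling_move :: "'a pair_pre_digraph \<Rightarrow> ('a \<Rightarrow> nat) \<Rightarrow> ('a \<Rightarrow> nat) \<Rightarrow> bool"
  for G where
  "(u, v) \<in> parcs G \<Longrightarrow> D u \<ge> 2 \<Longrightarrow> pebbling_move G D (D(u := D u - 2, v := D v + 1))"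

definition can_pebble :: "'a pair_pre_digraph \<Rightarrow> ('a \<Rightarrow> nat) \<Rightarrow> 'a \<Rightarrow> bool" where
  "can_pebble G D v \<longleftrightarrow> (\<exists>D'. (pebbling_move G)\<^sup>*\<^sup>* D D' \<and> D' v \<ge> 1)"

text \<open>
  For a finite connected graph and a vertex \<open>v\<close> a suitable \<open>N\<close> exists, so the \<open>LEAST\<close> below is
  well-defined.
\<close>

definition vertex_pebbling_number :: "'a pair_pre_digraph \<Rightarrow> 'a \<Rightarrow> nat" where
  "vertex_pebbling_number G v = (LEAST N. \<forall>D \<in> distributions G N. can_pebble G D v)"

definition pebbling_number :: "'a pair_pre_digraph \<Rightarrow> nat" where
  "pebbling_number G = Max (vertex_pebbling_number G ` pverts G)"

lemma pair_graph_cycle_graph: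
  assumes "k \<ge> 3"
  shows "pair_graph (cycle_graph k)"
proof -
  have "finite (parcs (cycle_graph k))"
    by (rule finite_subset[of _ "{0..<k} \<times> {0..<k}"]) (auto simp: cycle_graph_def)
  moreover have "(i + 1) mod k \<noteq> i" "i \<noteq> (i + 1) mod k" if "i < k" for i
    using that assms by (cases "i + 1 = k"; auto)+
  ultimately show ?thesis
    by unfold_locales (auto simp: cycle_graph_def symmetric_def intro: symI)
qed

lemma pair_graph_middle_graph:
  assumes "pair_graph G"
  shows "pair_graph (middle_graph G)"
proof -
  interpret pair_graph G by fact
  have E: "e \<subseteq> pverts G" if "e \<in> edge_set G" for e
    using that by (auto simp: edge_set_def dest: in_arcsD1 in_arcsD2)
  have fin: "finite (pverts (middle_graph G))"
    using finite_subset[of "edge_set G" "Pow (pverts G)"] E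
    by (auto simp: middle_graph_def)
  have sub: "parcs (middle_graph G) \<subseteq> pverts (middle_graph G) \<times> pverts (middle_graph G)"
    using E by (auto simp: middle_graph_def)
  have "finite (parcs (middle_graph G))"
    using finite_subset[OF sub] fin by simp
  moreover have "symmetric (middle_graph G)"
    by (auto simp: middle_graph_def symmetric_def intro!: symI)
  moreover have "fst e \<noteq> snd e" if "e \<in> parcs (middle_graph G)" for e
    using that by (auto simp: middle_graph_def)
  ultimately show ?thesis
    using fin sub by unfold_locales auto
qed

lemma pair_graph_cartesian_product:
  assumes "pair_graph G" "pair_graph H"
  shows "pair_graph (cartesian_product G H)"
proof -
  interpret G: pair_graph G by fact
  interpret H: pair_graph H by fact
  let ?P = "cartesian_product G H"
  have fin: "finite (pverts ?P)" by (simp add: cartesian_product_def)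
  have sub: "parcs ?P \<subseteq> pverts ?P \<times> pverts ?P"
    by (auto simp: cartesian_product_def
        dest: G.in_arcsD1 G.in_arcsD2 H.in_arcsD1 H.in_arcsD2)
  have "finite (parcs ?P)"
    using finite_subset[OF sub] fin by simp
  moreover have "symmetric ?P"
    using G.pair_sym_arcs H.pair_sym_arcs
    by (auto simp: cartesian_product_def symmetric_def intro!: symI dest: symD)
  moreover have "fst e \<noteq> snd e" if "e \<in> parcs ?P" for e
    using that by (auto simp: cartesian_product_def dest: G.pair_no_loops H.pair_no_loops)
  ultimately show ?thesis
    using fin sub by unfold_locales auto
qed

end

theory Submission
  imports Defs
begin

text \<open>
  Put \<open>W = 2\<^bsup>m+1\<^esup>\<close> and \<open>c = W + 2m - 3\<close>. Two mirrored weight functions on \<open>M(C\<^bsub>2m\<^esub>)\<close>, one for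
  each half of the cycle, show that more than \<open>c + tW\<close> pebbles suffice to bring \<open>t + 1\<close> of them to any
  root. Conversely \<open>f(M(C\<^bsub>2m\<^esub>)) \<ge> c + 1\<close>: put \<open>W - 1\<close> pebbles on the antipode of an original vertex and
  one on every further original vertex.

  By symmetry let \<open>n \<ge> m + 2\<close>. In the product, each of the \<open>4n\<close> copies of \<open>M(C\<^bsub>2m\<^esub>)\<close> sends its pebbles
  to the copy of \<open>M(C\<^bsub>2n\<^esub>)\<close> through the root, wasting at most \<open>c\<close> of them and paying \<open>W\<close> for each
  pebble that arrives. So \<open>4n c + W f(M(C\<^bsub>2n\<^esub>))\<close> pebbles suffice, and the lower bounds show that this is
  at most the product of the two pebbling numbers as soon as \<open>n \<ge> m + 2\<close> and \<open>m \<ge> 5\<close>.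
\<close>

section \<open>Pebbling in general graphs\<close>

text \<open>Counts pebbles instead of asking for one, since a column of a product has to deliver
  several pebbles to the row at once.\<close>

definition reaches :: "'a pair_pre_digraph \<Rightarrow> ('a \<Rightarrow> nat) \<Rightarrow> 'a \<Rightarrow> nat \<Rightarrow> bool" where
  "reaches G D v t \<longleftrightarrow> (\<exists>D'. (pebbling_move G)\<^sup>*\<^sup>* D D' \<and> t \<le> D' v)"

lemma can_pebble_iff_reaches: "can_pebble G D v \<longleftrightarrow> reaches G D v 1"
  by (simp add: can_pebble_def reaches_def)

lemma reaches_0: "reaches G D v 0"
  by (auto simp: reaches_def)

text \<open>Surplus pebbles can stay where they are: each move legal for the smaller distribution
  stays legal for the larger one.\<close>

lemma pebbling_moves_mono:
  assumes "(pebbling_move G)\<^sup>*\<^sup>* D D'" "D \<le> E"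
  shows "\<exists>E'. (pebbling_move G)\<^sup>*\<^sup>* E E' \<and> D' \<le> E'"
  using assms
proof (induction rule: rtranclp_induct)
  case base
  then show ?case by blast
next
  case (step B C)
  then obtain E' where E': "(pebbling_move G)\<^sup>*\<^sup>* E E'" "B \<le> E'" by blast
  from step.hyps(2) obtain u v where uv: "(u, v) \<in> parcs G" "B u \<ge> 2"
    and C: "C = B(u := B u - 2, v := B v + 1)"
    by (auto elim: pebbling_move.cases)
  let ?F = "E'(u := E' u - 2, v := E' v + 1)"
  have "pebbling_move G E' ?F"
    using uv E'(2) by (intro pebbling_move.intros) (auto simp: le_fun_def intro: order_trans)
  moreover have "C \<le> ?F"
    using E'(2) by (auto simp: C le_fun_def diff_le_mono)
  ultimately show ?case using E'(1) by (meson rtranclp.rtrancl_into_rtrancl)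
qed

lemma reaches_mono:
  assumes "reaches G D v t" "D \<le> E"
  shows "reaches G E v t"
  using assms pebbling_moves_mono unfolding reaches_def by (metis le_fun_def order_trans)

text \<open>Moves in a copy of \<open>G\<close> inside \<open>P\<close> are replayed there. What
  lies outside the copy is kept, so that several copies can be treated one after another.\<close>

lemma pebbling_moves_lift:
  assumes "(pebbling_move G)\<^sup>*\<^sup>* E E'"
    and "inj \<iota>" and arcs: "\<And>u v. (u, v) \<in> parcs G \<Longrightarrow> (\<iota> u, \<iota> v) \<in> parcs P"
    and "\<And>x. D (\<iota> x) = E x"
  shows "\<exists>D'. (pebbling_move P)\<^sup>*\<^sup>* D D' \<and> (\<forall>x. D' (\<iota> x) = E' x) \<and>
           (\<forall>z. z \<notin> range \<iota> \<longrightarrow> D' z = D z)"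
  using assms(1)
proof (induction rule: rtranclp_induct)
  case base
  then show ?case using assms(4) by blast
next
  case (step B C)
  then obtain D' where D': "(pebbling_move P)\<^sup>*\<^sup>* D D'" "\<And>x. D' (\<iota> x) = B x"
    "\<And>z. z \<notin> range \<iota> \<Longrightarrow> D' z = D z" by blast
  from step.hyps(2) obtain u v where uv: "(u, v) \<in> parcs G" "B u \<ge> 2"
    and C: "C = B(u := B u - 2, v := B v + 1)"
    by (auto elim: pebbling_move.cases)
  let ?F = "D'(\<iota> u := D' (\<iota> u) - 2, \<iota> v := D' (\<iota> v) + 1)"
  have "pebbling_move P D' ?F"
    using uv D'(2) arcs by (intro pebbling_move.intros) auto
  then have "(pebbling_move P)\<^sup>*\<^sup>* D ?F" using D'(1) by (meson rtranclp.rtrancl_into_rtrancl)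
  moreover have "?F (\<iota> x) = C x" for x
    using \<open>inj \<iota>\<close> D'(2) by (auto simp: C inj_eq)
  moreover have "?F z = D z" if "z \<notin> range \<iota>" for z
    using that D'(3) by auto
  ultimately show ?case by blast
qed

lemma reaches_lift:
  assumes "reaches G (\<lambda>x. D (\<iota> x)) v t"
    and "inj \<iota>" "\<And>u v. (u, v) \<in> parcs G \<Longrightarrow> (\<iota> u, \<iota> v) \<in> parcs P"
  shows "reaches P D (\<iota> v) t"
proof -
  obtain E' where E': "(pebbling_move G)\<^sup>*\<^sup>* (\<lambda>x. D (\<iota> x)) E'" "t \<le> E' v"
    using assms(1) by (auto simp: reaches_def)
  show ?thesis
    using pebbling_moves_lift[OF E'(1) assms(2,3), where D = D] E'(2)
    unfolding reaches_def by force
qed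

text \<open>Pebbles are kept greedily until \<open>N\<close> of them are collected. This leads from
  "at least \<open>N\<close> pebbles" to the exact total in \<open>distributions\<close>.\<close>

lemma ex_subfunction_with_sum:
  fixes D :: "'a \<Rightarrow> nat"
  assumes "finite V" "N \<le> (\<Sum>x\<in>V. D x)"
  shows "\<exists>E. E \<le> D \<and> (\<forall>x. x \<notin> V \<longrightarrow> E x = 0) \<and> (\<Sum>x\<in>V. E x) = N"
  using assms
proof (induction V arbitrary: N rule: finite_induct)
  case empty
  then show ?case by (intro exI[of _ "\<lambda>_. 0"]) (auto simp: le_fun_def)
next
  case (insert a V)
  let ?k = "min N (D a)"
  have "N - ?k \<le> (\<Sum>x\<in>V. D x)" using insert by (auto simp: min_def)
  from insert.IH[OF this] obtain E where E: "E \<le> D" "\<And>x. x \<notin> V \<Longrightarrow> E x = 0"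
    "(\<Sum>x\<in>V. E x) = N - ?k" by blast
  have "(\<Sum>x\<in>V. (E(a := ?k)) x) = N - ?k"
    using insert.hyps E(3) by (subst E(3)[symmetric]) (intro sum.cong, auto)
  then show ?case using insert.hyps E
    by (intro exI[of _ "E(a := ?k)"]) (auto simp: le_fun_def)
qed

text \<open>The number \<open>M\<close> witnesses that the \<open>LEAST\<close> in the definition is
  attained; pebbles beyond that least number are discarded.\<close>

lemma can_pebble_of_vertex_pebbling_number:
  assumes "finite (pverts G)"
    and "\<And>D. D \<in> distributions G M \<Longrightarrow> can_pebble G D v"
    and "vertex_pebbling_number G v \<le> (\<Sum>x\<in>pverts G. D x)"
  shows "can_pebble G D v"
proof -
  let ?N = "vertex_pebbling_number G v"
  have N: "\<forall>D \<in> distributions G ?N. can_pebble G D v"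
    unfolding vertex_pebbling_number_def
    by (rule LeastI[where P = "\<lambda>N. \<forall>D \<in> distributions G N. can_pebble G D v" and k = M])
       (use assms(2) in blast)
  obtain E where "E \<le> D" "E \<in> distributions G ?N"
    using ex_subfunction_with_sum[OF assms(1,3)] by (auto simp: distributions_def)
  then show ?thesis using N reaches_mono by (metis can_pebble_iff_reaches)
qed

lemma sum_pebbling_move:
  fixes w D :: "'a \<Rightarrow> nat"
  assumes "finite V" "u \<in> V" "v \<in> V" "u \<noteq> v" "D u \<ge> 2"
  shows "(\<Sum>x\<in>V. w x * (D(u := D u - 2, v := D v + 1)) x) + 2 * w u = (\<Sum>x\<in>V. w x * D x) + w v"
proof -
  have "(\<Sum>x\<in>V. w x * (D(u := D u - 2, v := D v + 1)) x) + (\<Sum>x\<in>V. if x = u then 2 * w u else 0)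
      = (\<Sum>x\<in>V. w x * D x) + (\<Sum>x\<in>V. if x = v then w v else 0)"
    unfolding sum.distrib[symmetric]
    using assms by (intro sum.cong) (auto simp: diff_mult_distrib2)
  then show ?thesis using assms by simp
qed

text \<open>
  Moving towards \<open>r\<close> along the arcs chosen in \<open>parent\<close> never loses
  weight, and a vertex other than \<open>r\<close> carrying two pebbles exists as long as the weight is large.
\<close>

lemma reaches_of_weight:
  fixes w :: "'a \<Rightarrow> nat"
  assumes fin: "finite (pverts G)" and r: "r \<in> pverts G"
    and parent: "\<And>v. v \<in> pverts G \<Longrightarrow> v \<noteq> r \<Longrightarrow> w v > 0 \<Longrightarrow>
      \<exists>u\<in>pverts G. (v, u) \<in> parcs G \<and> 2 * w v \<le> w u"
    and big: "(\<Sum>v\<in>pverts G - {r}. w v) + t * w r < (\<Sum>v\<in>pverts G. w v * D v)"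
  shows "reaches G D r (Suc t)"
  using big
proof (induction "\<Sum>v\<in>pverts G. D v" arbitrary: D rule: less_induct)
  case less
  let ?V = "pverts G"
  show ?case
  proof (cases "D r \<le> t")
    case False
    then show ?thesis by (auto simp: reaches_def intro!: exI[of _ D])
  next
    case True
    have "(\<Sum>v\<in>?V. w v * D v) = w r * D r + (\<Sum>v\<in>?V - {r}. w v * D v)"
      using fin r by (rule sum.remove)
    moreover have "w r * D r \<le> t * w r" using True by simp
    \<comment> \<open>Excess weight outside \<open>r\<close> forces some term
      \<open>w v * D v\<close> above \<open>w v\<close>, so a vertex of positive weight carries at
      least two pebbles.\<close>
    ultimately have "(\<Sum>v\<in>?V - {r}. w v) < (\<Sum>v\<in>?V - {r}. w v * D v)"
      using less.prems by linarith
    then obtain v where v: "v \<in> ?V - {r}" "w v < w v * D v"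
      by (meson not_le sum_mono)
    then have "w v > 0" "D v \<ge> 2" by (cases "D v"; cases "D v - 1"; auto)+
    then obtain u where u: "u \<in> ?V" "(v, u) \<in> parcs G" "2 * w v \<le> w u" using parent v by blast
    have "v \<noteq> u" using u \<open>w v > 0\<close> by auto
    let ?E = "D(v := D v - 2, u := D u + 1)"
    have mv: "pebbling_move G D ?E" using u \<open>D v \<ge> 2\<close> by (intro pebbling_move.intros)
    have S: "(\<Sum>x\<in>?V. w' x * ?E x) + 2 * w' v = (\<Sum>x\<in>?V. w' x * D x) + w' u" for w'
      using fin u v \<open>v \<noteq> u\<close> \<open>D v \<ge> 2\<close> by (intro sum_pebbling_move) auto
    have "(\<Sum>x\<in>?V. ?E x) < (\<Sum>x\<in>?V. D x)" using S[of "\<lambda>_. 1"] by simp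
    moreover have "(\<Sum>x\<in>?V. w x * D x) \<le> (\<Sum>x\<in>?V. w x * ?E x)" using S[of w] u by linarith
    ultimately have "reaches G ?E r (Suc t)" using less by (meson order_less_le_trans)
    then show ?thesis using mv unfolding reaches_def by (meson converse_rtranclp_into_rtranclp)
  qed
qed

text \<open>
  On a vertex of \<open>S\<close> only pairs of pebbles count, so single pebbles can be put on \<open>S\<close> for free.
\<close>

lemma not_can_pebble_of_potential:
  fixes G :: "'a pair_pre_digraph" and c :: "'a \<Rightarrow> nat" and S :: "'a set"
  defines "\<Phi> \<equiv> \<lambda>D. \<Sum>x\<in>pverts G. c x * (if x \<in> S then D x div 2 else D x)"
  assumes "pair_graph G" and r: "r \<in> pverts G" "r \<notin> S"
    and arc1: "\<And>u v. (u, v) \<in> parcs G \<Longrightarrow> u \<notin> S \<Longrightarrow> c v \<le> 2 * c u"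
    and arc2: "\<And>u v. (u, v) \<in> parcs G \<Longrightarrow> u \<in> S \<Longrightarrow> v \<notin> S \<and> c v \<le> c u"
    and small: "\<Phi> D < c r"
  shows "\<not> can_pebble G D r"
proof
  interpret pair_graph G by fact
  \<comment> \<open>Leaving \<open>u\<close> costs \<open>c u\<close> on \<open>S\<close>, where two
    pebbles form one pair, and \<open>2 * c u\<close> elsewhere. Arriving at \<open>v\<close> adds
    at most \<open>c v\<close>, which the arc conditions balance.\<close>
  have step: "\<Phi> E \<le> \<Phi> B" if "pebbling_move G B E" for B E
    using that
  proof cases
    case (1 u v)
    have uv: "u \<in> pverts G" "v \<in> pverts G" "u \<noteq> v"
      using 1 by (auto dest: in_arcsD1 in_arcsD2 pair_no_loops)
    have "(\<Sum>x\<in>pverts G. c x * (if x \<in> S then E x div 2 else E x))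
          + (\<Sum>x\<in>pverts G. if x = u then (if u \<in> S then c u else 2 * c u) else 0)
        \<le> (\<Sum>x\<in>pverts G. c x * (if x \<in> S then B x div 2 else B x))
          + (\<Sum>x\<in>pverts G. if x = v then c v else 0)"
      unfolding sum.distrib[symmetric]
    proof (rule sum_mono)
      fix x
      have "B u div 2 = Suc ((B u - 2) div 2)" using 1(3) by (simp add: le_div_geq)
      moreover have "c v * (Suc (B v) div 2) \<le> c v * Suc (B v div 2)" 
        by (intro mult_le_mono2) presburger
      ultimately show "c x * (if x \<in> S then E x div 2 else E x) +
            (if x = u then if u \<in> S then c u else 2 * c u else 0)
          \<le> c x * (if x \<in> S then B x div 2 else B x) + (if x = v then c v else 0)"
        using uv(3) 1(3) by (auto simp: 1(1) diff_mult_distrib2)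
    qed
    then have "\<Phi> E + (if u \<in> S then c u else 2 * c u) \<le> \<Phi> B + c v"
      using uv by (simp add: \<Phi>_def)
    then show ?thesis using arc1[OF 1(2)] arc2[OF 1(2)] by (auto split: if_splits)
  qed
  assume "can_pebble G D r"
  then obtain D' where D': "(pebbling_move G)\<^sup>*\<^sup>* D D'" "D' r \<ge> 1" by (auto simp: can_pebble_def)
  from D'(1) have "\<Phi> D' \<le> \<Phi> D" by (induction rule: rtranclp_induct) (auto dest: step)
  moreover have "c r * (if r \<in> S then D' r div 2 else D' r) \<le> \<Phi> D'"
    unfolding \<Phi>_def by (rule member_le_sum) (use r in auto)
  moreover have "c r \<le> c r * D' r" using D'(2) by simp
  ultimately show False using small r(2) by simp
qed


section \<open>Cartesian products\<close>

text \<open>The columns are emptied one at a time. The second conclusion is the invariant that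
  columns not yet treated still hold their original pebbles.\<close>

lemma reaches_columns:
  assumes "finite X" "X \<subseteq> pverts G"
    and "\<And>x. x \<in> X \<Longrightarrow> reaches H (\<lambda>y. D (x, y)) r (t x)"
  shows "\<exists>D'. (pebbling_move (cartesian_product G H))\<^sup>*\<^sup>* D D' \<and> (\<forall>x\<in>X. t x \<le> D' (x, r)) \<and>
           (\<forall>x y. x \<notin> X \<longrightarrow> D' (x, y) = D (x, y))"
  using assms
proof (induction X rule: finite_induct)
  case empty
  then show ?case by blast
next
  case (insert a X)
  let ?P = "cartesian_product G H"
  obtain D1 where D1: "(pebbling_move ?P)\<^sup>*\<^sup>* D D1" "\<And>x. x \<in> X \<Longrightarrow> t x \<le> D1 (x, r)"
    "\<And>x y. x \<notin> X \<Longrightarrow> D1 (x, y) = D (x, y)" using insert by auto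
  obtain E where E: "(pebbling_move H)\<^sup>*\<^sup>* (\<lambda>y. D (a, y)) E" "t a \<le> E r"
    using insert.prems(2)[of a] by (auto simp: reaches_def)
  have "inj (Pair a)" by (simp add: inj_def)
  moreover have "((a, u), (a, v)) \<in> parcs ?P" if "(u, v) \<in> parcs H" for u v
    using that insert.prems(1) by (auto simp: cartesian_product_def)
  ultimately obtain D2 where D2: "(pebbling_move ?P)\<^sup>*\<^sup>* D1 D2" "\<And>y. D2 (a, y) = E y"
    "\<And>z. z \<notin> range (Pair a) \<Longrightarrow> D2 z = D1 z"
    using pebbling_moves_lift[OF E(1), of "Pair a" ?P D1] D1(3) insert.hyps by auto
  have other: "D2 (x, y) = D1 (x, y)" if "x \<noteq> a" for x y
    using that D2(3)[of "(x, y)"] by auto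
  have "(pebbling_move ?P)\<^sup>*\<^sup>* D D2" using D1(1) D2(1) by (rule rtranclp_trans)
  moreover have "t x \<le> D2 (x, r)" if "x \<in> insert a X" for x
    using that E(2) D2(2) D1(2)[of x] other[of x r] by (cases "x = a") auto
  moreover have "D2 (x, y) = D (x, y)" if "x \<notin> insert a X" for x y
    using that D1(3) other by auto
  ultimately show ?case by blast
qed

text \<open>
  Each column \<open>{x} \<times> H\<close> sends its pebbles to the row \<open>G \<times> {s}\<close>, wasting at most \<open>c\<close> of them and
  paying \<open>W\<close> for each of the others; the row then needs \<open>F\<close> pebbles.
\<close>

lemma can_pebble_cartesian_product:
  assumes fin: "finite (pverts G)" and s: "s \<in> pverts H"
    and col: "\<And>E t. c + t * W < (\<Sum>y\<in>pverts H. E y) \<Longrightarrow> reaches H E s (Suc t)"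
    and row: "\<And>E. F \<le> (\<Sum>x\<in>pverts G. E x) \<Longrightarrow> can_pebble G E r"
    and W: "W > 0"
    and N: "card (pverts G) * c + W * F \<le> N"
    and D: "D \<in> distributions (cartesian_product G H) N"
  shows "can_pebble (cartesian_product G H) D (r, s)"
proof -
  let ?P = "cartesian_product G H"
  define p where "p x = (\<Sum>y\<in>pverts H. D (x, y))" for x
  \<comment> \<open>The quotient of \<open>p x - c\<close> by \<open>W\<close> rounded up, or 0 if
    the difference is negative: the number of pebbles that column \<open>x\<close> is sure to
    deliver.\<close>
  define t where "t x = (LEAST t. p x \<le> c + t * W)" for x
  have t: "p x \<le> c + t x * W" for x
    unfolding t_def
  proof (rule LeastI[where k = "p x"])
    have "p x \<le> p x * W" using W by simp
    then show "p x \<le> c + p x * W" by linarith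
  qed
  have col': "reaches H (\<lambda>y. D (x, y)) s (t x)" for x
  proof (cases "t x")
    case 0
    then show ?thesis by (simp add: reaches_0)
  next
    case (Suc k)
    \<comment> \<open>Minimality of \<open>t x\<close> makes \<open>k\<close> too small, which is
      the premise of \<open>col\<close>.\<close>
    then have "\<not> p x \<le> c + k * W" using not_less_Least[of k "\<lambda>t. p x \<le> c + t * W"]
      by (simp add: t_def)
    then show ?thesis using Suc col[of k "\<lambda>y. D (x, y)"] by (simp add: p_def)
  qed
  obtain D1 where D1: "(pebbling_move ?P)\<^sup>*\<^sup>* D D1" "\<And>x. x \<in> pverts G \<Longrightarrow> t x \<le> D1 (x, s)"
    using reaches_columns[OF fin order_refl, of H D s t] col' by blast
  have "N = (\<Sum>x\<in>pverts G. p x)"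
    using D by (simp add: distributions_def cartesian_product_def p_def sum.cartesian_product)
  also have "\<dots> \<le> (\<Sum>x\<in>pverts G. c + t x * W)" by (intro sum_mono t)
  also have "\<dots> = card (pverts G) * c + W * (\<Sum>x\<in>pverts G. t x)"
    by (simp add: sum.distrib sum_distrib_left mult.commute)
  finally have "W * F \<le> W * (\<Sum>x\<in>pverts G. t x)" using N by linarith
  then have "F \<le> (\<Sum>x\<in>pverts G. t x)" using W by simp
  also have "\<dots> \<le> (\<Sum>x\<in>pverts G. D1 (x, s))" by (intro sum_mono D1)
  finally have "reaches G (\<lambda>x. D1 (x, s)) r 1" using row by (simp add: can_pebble_iff_reaches)
  moreover have "inj (\<lambda>x. (x, s))" by (simp add: inj_def)
  moreover have "((u, s), (v, s)) \<in> parcs ?P" if "(u, v) \<in> parcs G" for u v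
    using that s by (auto simp: cartesian_product_def)
  ultimately have "reaches ?P D1 (r, s) 1" by (rule reaches_lift)
  then show ?thesis
    using D1(1) unfolding can_pebble_iff_reaches reaches_def by (meson rtranclp_trans)
qed

text \<open>Exchanging the factors is an isomorphism; this justifies assuming that a particular
  factor has the longer cycle.\<close>

lemma can_pebble_cartesian_product_swap:
  assumes "\<And>D. D \<in> distributions (cartesian_product H G) N \<Longrightarrow>
      can_pebble (cartesian_product H G) D (s, r)"
    and D: "D \<in> distributions (cartesian_product G H) N"
  shows "can_pebble (cartesian_product G H) D (r, s)"
proof -
  have "(\<Sum>z\<in>pverts H \<times> pverts G. D (prod.swap z)) = (\<Sum>z\<in>pverts G \<times> pverts H. D z)"
    by (rule sum.reindex_bij_witness[of _ prod.swap prod.swap]) auto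
  then have "(\<lambda>z. D (prod.swap z)) \<in> distributions (cartesian_product H G) N"
    using D by (auto simp: distributions_def cartesian_product_def)
  then have "reaches (cartesian_product H G) (\<lambda>z. D (prod.swap z)) (s, r) 1"
    using assms(1) by (simp add: can_pebble_iff_reaches)
  then have "reaches (cartesian_product G H) D (prod.swap (s, r)) 1"
    by (rule reaches_lift) (auto simp: cartesian_product_def)
  then show ?thesis by (simp add: can_pebble_iff_reaches)
qed

section \<open>Middle graphs of cycles\<close>

text \<open>
  The vertices of \<open>M(C\<^sub>k)\<close> are placed on a circle of length \<open>2k\<close>: the original vertex \<open>a\<close> at
  position \<open>2a\<close>, the edge between \<open>a\<close> and \<open>a + 1\<close> at position \<open>2a + 1\<close>.
\<close>

definition node :: "nat \<Rightarrow> int \<Rightarrow> nat" where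
  "node k a = nat (a mod int k)"

definition place :: "nat \<Rightarrow> int \<Rightarrow> nat + nat set" where
  "place k p = (if even p then Inl (node k (p div 2)) else Inr {node k (p div 2), node k (p div 2 + 1)})"

lemma node_eq_iff: "k > 0 \<Longrightarrow> node k a = node k b \<longleftrightarrow> a mod int k = b mod int k"
  by (simp add: node_def eq_nat_nat_iff)

lemma node_Suc_eq_iff: "k > 0 \<Longrightarrow> node k (a + 1) = node k (b + 1) \<longleftrightarrow> node k a = node k b"
  using mod_add_cong[of a "int k" b 1 1] mod_diff_cong[of "a + 1" "int k" "b + 1" 1 1]
  by (auto simp: node_eq_iff)

text \<open>Integer representatives remove the case distinction where the numbering of the cycle
  wraps around.\<close>

lemma parcs_cycle_graph:
  assumes "k > 0"
  shows "(i, j) \<in> parcs (cycle_graph k) \<longleftrightarrow>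
    (\<exists>a. i = node k a \<and> j = node k (a + 1) \<or> i = node k (a + 1) \<and> j = node k a)"
proof -
  have S: "node k (a + 1) = (node k a + 1) mod k" for a
  proof -
    have "int ((node k a + 1) mod k) = (a mod int k + 1) mod int k"
      using assms by (simp add: node_def zmod_int add.commute)
    also have "\<dots> = int (node k (a + 1))" using assms by (simp add: node_def mod_simps)
    finally show ?thesis by simp
  qed
  have int_node: "node k (int i) = i" if "i < k" for i using that by (simp add: node_def)
  have lt: "node k a < k" for a using assms by (simp add: node_def nat_less_iff)
  show ?thesis
  proof
    assume "(i, j) \<in> parcs (cycle_graph k)"
    then have "i < k" "j < k" "j = (i + 1) mod k \<or> i = (j + 1) mod k" by (auto simp: cycle_graph_def)
    then show "\<exists>a. i = node k a \<and> j = node k (a + 1) \<or> i = node k (a + 1) \<and> j = node k a"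
      using S[of "int i"] S[of "int j"] int_node by metis
  next
    assume "\<exists>a. i = node k a \<and> j = node k (a + 1) \<or> i = node k (a + 1) \<and> j = node k a"
    then show "(i, j) \<in> parcs (cycle_graph k)" using lt assms by (auto simp: cycle_graph_def S)
  qed
qed

lemma pverts_cycle_graph:
  assumes "k > 0"
  shows "pverts (cycle_graph k) = range (node k)"
proof -
  have "node k (int i) = i" if "i < k" for i using that by (simp add: node_def)
  moreover have "node k a < k" for a using assms by (simp add: node_def nat_less_iff)
  ultimately show ?thesis by (auto simp: cycle_graph_def image_iff) metis
qed

lemma edge_set_cycle_graph:
  assumes "k > 0"
  shows "edge_set (cycle_graph k) = range (\<lambda>a. {node k a, node k (a + 1)})"
  using assms by (auto simp: edge_set_def parcs_cycle_graph)

text \<open>Equality in crossed order would make \<open>b + 2\<close> congruent to \<open>b\<close>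
  modulo \<open>k\<close>, so that \<open>k\<close> divides 2.\<close>

lemma edge_eq_iff:
  assumes "k \<ge> 3"
  shows "{node k a, node k (a + 1)} = {node k b, node k (b + 1)} \<longleftrightarrow> node k a = node k b"
proof
  assume eq: "{node k a, node k (a + 1)} = {node k b, node k (b + 1)}"
  show "node k a = node k b"
  proof (rule ccontr)
    assume "node k a \<noteq> node k b"
    then have 1: "node k a = node k (b + 1)" and 2: "node k (a + 1) = node k b"
      using eq by (auto simp: doubleton_eq_iff)
    have "node k (b + 1 + 1) = node k b" using 1 2 node_Suc_eq_iff[of k a "b + 1"] assms by simp
    then have "int k dvd (b + 1 + 1) - b" using assms by (simp add: node_eq_iff mod_eq_dvd_iff)
    then have "int k dvd 2" by simp
    then show False using assms zdvd_imp_le[of "int k" 2] by simp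
  qed
next
  assume "node k a = node k b"
  then show "{node k a, node k (a + 1)} = {node k b, node k (b + 1)}"
    using assms node_Suc_eq_iff[of k a b] by simp
qed

text \<open>Parity survives reduction modulo the even number \<open>2 * k\<close>, so original and
  edge vertices never mix; within each kind the residue of \<open>p div 2\<close> modulo
  \<open>k\<close> decides.\<close>

lemma place_eq_iff:
  assumes "k \<ge> 3"
  shows "place k p = place k q \<longleftrightarrow> p mod (2 * int k) = q mod (2 * int k)"
proof -
  have P: "even (x mod (2 * int k)) \<longleftrightarrow> even x" for x by (simp add: dvd_mod_iff)
  consider a b where "p = 2 * a" "q = 2 * b" | a b where "p = 2 * a + 1" "q = 2 * b + 1"
    | "even p \<noteq> even q"
    by (metis evenE oddE)
  then show ?thesis
  proof cases
    case 1
    then show ?thesis using assms by (simp add: place_def node_eq_iff)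
  next
    case 2
    have "(2 * x + 1) mod (2 * int k) = 2 * (x mod int k) + 1" for x
      using pos_zmod_mult_2[of "int k" x] by (simp add: add.commute)
    then show ?thesis using 2 assms edge_eq_iff[OF assms, of a b] by (simp add: place_def node_eq_iff)
  next
    case 3
    then show ?thesis using P[of p] P[of q] by (auto simp: place_def)
  qed
qed

lemma pverts_middle_cycle:
  assumes "k > 0"
  shows "pverts (middle_graph (cycle_graph k)) = range (place k)"
proof -
  have "place k (2 * a) = Inl (node k a)"
    "place k (2 * a + 1) = Inr {node k a, node k (a + 1)}" for a
    by (simp_all add: place_def)
  then have mem: "Inl (node k a) \<in> range (place k)"
    "Inr {node k a, node k (a + 1)} \<in> range (place k)" for a
    by (metis rangeI)+
  have V: "pverts (middle_graph (cycle_graph k)) =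
      range (\<lambda>a. Inl (node k a)) \<union> range (\<lambda>a. Inr {node k a, node k (a + 1)})"
    using assms
    by (simp add: middle_graph_def pverts_cycle_graph edge_set_cycle_graph image_image)
  show ?thesis
  proof
    show "pverts (middle_graph (cycle_graph k)) \<subseteq> range (place k)"
      unfolding V by (intro Un_least image_subsetI mem)
    show "range (place k) \<subseteq> pverts (middle_graph (cycle_graph k))"
      by (intro image_subsetI) (simp add: V place_def)
  qed
qed

text \<open>Steps of length 1 join an edge to its endpoints, steps of length 2 between odd positions
  join consecutive edges. Adjacency thus becomes a matter of differences of positions.\<close>

lemma parcs_middle_cycle:
  assumes k: "k \<ge> 3"
  shows "(u, v) \<in> parcs (middle_graph (cycle_graph k)) \<longleftrightarrow>
    (\<exists>p q. u = place k p \<and> v = place k q \<and> (\<bar>p - q\<bar> = 1 \<or> odd p \<and> \<bar>p - q\<bar> = 2))"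
    (is "_ \<in> ?A \<longleftrightarrow> ?R")
proof
  have E: "edge_set (cycle_graph k) = range (\<lambda>a. {node k a, node k (a + 1)})"
    using k by (simp add: edge_set_cycle_graph)
  have even_place: "place k (2 * a) = Inl (node k a)"
    and odd_place: "place k (2 * a + 1) = Inr {node k a, node k (a + 1)}" for a
    by (simp_all add: place_def)
  show ?R if "(u, v) \<in> ?A"
  proof -
    have inc: "\<exists>p q. Inl x = place k p \<and> Inr e = place k q \<and> \<bar>p - q\<bar> = 1"
      if xe: "e \<in> edge_set (cycle_graph k)" "x \<in> e" for x e
    proof -
      obtain a where a: "e = {node k a, node k (a + 1)}" using xe E by auto
      then have e: "Inr e = place k (2 * a + 1)" by (simp add: odd_place)
      from a xe consider "x = node k a" | "x = node k (a + 1)" by auto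
      then show ?thesis
      proof cases
        case 1
        then show ?thesis using e even_place[of a] by (intro exI[of _ "2 * a"] exI[of _ "2 * a + 1"]) simp
      next
        case 2
        then show ?thesis using e even_place[of "a + 1"]
          by (intro exI[of _ "2 * (a + 1)"] exI[of _ "2 * a + 1"]) simp
      qed
    qed
    have adj: "\<exists>p q. Inr e = place k p \<and> Inr e' = place k q \<and> odd p \<and> \<bar>p - q\<bar> = 2"
      if ee: "e \<in> edge_set (cycle_graph k)" "e' \<in> edge_set (cycle_graph k)" "e \<noteq> e'" "e \<inter> e' \<noteq> {}"
      for e e'
    proof -
      obtain a b where a: "e = {node k a, node k (a + 1)}" and b: "e' = {node k b, node k (b + 1)}"
        using ee E by auto
      have ne: "node k a \<noteq> node k b" using ee(3) edge_eq_iff[OF k, of a b] a b by simp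
      then have "node k (a + 1) \<noteq> node k (b + 1)" using k node_Suc_eq_iff[of k a b] by simp
      \<comment> \<open>With neither the left nor the right ends equal, a shared endpoint makes the
        two edges consecutive.\<close>
      with ne ee(4) a b consider "node k a = node k (b + 1)" | "node k b = node k (a + 1)" by auto
      then show ?thesis
      proof cases
        case 1
        then have "e = {node k (b + 1), node k (b + 1 + 1)}" using a edge_eq_iff[OF k, of a "b + 1"] by simp
        then show ?thesis using b odd_place[of b] odd_place[of "b + 1"]
          by (intro exI[of _ "2 * (b + 1) + 1"] exI[of _ "2 * b + 1"]) simp
      next
        case 2
        then have "e' = {node k (a + 1), node k (a + 1 + 1)}" using b edge_eq_iff[OF k, of b "a + 1"] by simp
        then show ?thesis using a odd_place[of a] odd_place[of "a + 1"]
          by (intro exI[of _ "2 * a + 1"] exI[of _ "2 * (a + 1) + 1"]) simp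
      qed
    qed
    consider x e where "u = Inl x" "v = Inr e" "e \<in> edge_set (cycle_graph k)" "x \<in> e"
      | x e where "u = Inr e" "v = Inl x" "e \<in> edge_set (cycle_graph k)" "x \<in> e"
      | e e' where "u = Inr e" "v = Inr e'" "e \<in> edge_set (cycle_graph k)"
          "e' \<in> edge_set (cycle_graph k)" "e \<noteq> e'" "e \<inter> e' \<noteq> {}"
      using \<open>(u, v) \<in> ?A\<close> by (simp add: middle_graph_def) blast
    then show ?R
    proof cases
      case 1
      then show ?thesis using inc by blast
    next
      case 2
      then show ?thesis using inc[of e x] by (metis abs_minus_commute)
    next
      case 3
      then show ?thesis using adj by blast
    qed
  qed
  show "(u, v) \<in> ?A" if ?R
  proof -
    have inc: "(place k p, place k q) \<in> ?A \<and> (place k q, place k p) \<in> ?A"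
      if "even p" and pq: "\<bar>p - q\<bar> = 1" for p q
    proof -
      obtain a where p: "p = 2 * a" using \<open>even p\<close> by (elim evenE)
      consider "q = 2 * a + 1" | "q = 2 * (a - 1) + 1" using pq p by (auto simp: abs_if split: if_splits)
      then show ?thesis
      proof cases
        case 1
        show ?thesis unfolding p 1 even_place odd_place by (auto simp: middle_graph_def E)
      next
        case 2
        show ?thesis unfolding p 2 even_place odd_place
          by (auto simp: middle_graph_def E intro!: exI[of _ "a - 1"])
      qed
    qed
    have adj: "(place k (2 * a + 1), place k (2 * (a + 1) + 1)) \<in> ?A \<and>
        (place k (2 * (a + 1) + 1), place k (2 * a + 1)) \<in> ?A" for a
    proof -
      have "node k a \<noteq> node k (a + 1)"
        using k zdvd_imp_le[of "int k" 1] by (auto simp: node_eq_iff mod_eq_dvd_iff)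
      then have "{node k a, node k (a + 1)} \<noteq> {node k (a + 1), node k (a + 1 + 1)}"
        using edge_eq_iff[OF k, of a "a + 1"] by simp
      then show ?thesis unfolding odd_place by (auto simp: middle_graph_def E)
    qed
    obtain p q where pq: "u = place k p" "v = place k q" "\<bar>p - q\<bar> = 1 \<or> odd p \<and> \<bar>p - q\<bar> = 2"
      using \<open>?R\<close> by blast
    from pq(3) consider "\<bar>p - q\<bar> = 1" "even p" | "\<bar>q - p\<bar> = 1" "even q"
      | "odd p" "q = p + 2" | "odd p" "q = p - 2"
      by (smt (verit) even_add odd_one)
    then show ?thesis
    proof cases
      case 3
      then obtain a where "p = 2 * a + 1" by (elim oddE)
      then show ?thesis using adj[of a] 3 pq by (simp add: algebra_simps)
    next
      case 4
      then obtain a where "p = 2 * a + 1" by (elim oddE)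
      then have "p = 2 * (a - 1 + 1) + 1" "q = 2 * (a - 1) + 1" using 4 by auto
      then show ?thesis using adj[of "a - 1"] pq by simp
    qed (use inc pq in blast)+
  qed
qed

lemma pair_graph_middle_cycle: "k \<ge> 3 \<Longrightarrow> pair_graph (middle_graph (cycle_graph k))"
  by (intro pair_graph_middle_graph pair_graph_cycle_graph)

text \<open>
  The position of a vertex as seen from position \<open>r\<close> when running through the circle in direction
  \<open>s = 1\<close> or \<open>s = -1\<close>.
\<close>

definition offset :: "nat \<Rightarrow> int \<Rightarrow> int \<Rightarrow> nat + nat set \<Rightarrow> nat" where
  "offset k r s v = nat ((s * ((SOME p. place k p = v) - r)) mod (2 * int k))"

text \<open>The choice inside \<open>offset\<close> is harmless, because two positions of the same
  vertex differ by a multiple of \<open>2 * k\<close>.\<close>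

lemma offset_place:
  assumes "k \<ge> 3"
  shows "offset k r s (place k p) = nat ((s * (p - r)) mod (2 * int k))"
proof -
  let ?q = "SOME q. place k q = place k p"
  have "place k ?q = place k p" by (rule someI_ex) blast
  then have "?q mod (2 * int k) = p mod (2 * int k)" using assms by (simp add: place_eq_iff)
  then have "(s * (?q - r)) mod (2 * int k) = (s * (p - r)) mod (2 * int k)"
    by (intro mod_mult_cong mod_diff_cong) auto
  then show ?thesis by (simp add: offset_def)
qed

lemma offset_place_nat:
  assumes "k \<ge> 3" "s = 1 \<or> s = -1" "p < 2 * k"
  shows "offset k r s (place k (r + s * int p)) = p"
proof -
  have "s * (r + s * int p - r) = int p" using assms(2) by auto
  then show ?thesis using assms(1,3) by (simp only: offset_place mod_pos_pos_trivial)
qed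

lemma ex_place_nat:
  assumes "k \<ge> 3" "s = 1 \<or> s = -1" "v \<in> pverts (middle_graph (cycle_graph k))"
  shows "\<exists>p<2 * k. v = place k (r + s * int p)"
proof -
  obtain q where q: "v = place k q" using assms by (auto simp: pverts_middle_cycle)
  let ?p = "(s * (q - r)) mod (2 * int k)"
  have "(r + s * ?p) mod (2 * int k) = (r + s * (s * (q - r))) mod (2 * int k)"
    by (metis mod_add_right_eq mod_mult_right_eq)
  also have "r + s * (s * (q - r)) = q" using assms(2) by auto
  finally have "place k (r + s * ?p) = v" using assms(1) q by (simp add: place_eq_iff)
  moreover have "0 \<le> ?p" "?p < 2 * int k" using assms(1) by auto
  ultimately show ?thesis by (intro exI[of _ "nat ?p"]) (auto simp: nat_less_iff)
qed

lemma bij_betw_place: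
  assumes "k \<ge> 3" "s = 1 \<or> s = -1"
  shows "bij_betw (\<lambda>p. place k (r + s * int p)) {..<2 * k} (pverts (middle_graph (cycle_graph k)))"
proof (rule bij_betwI')
  fix x y assume xy: "x \<in> {..<2 * k}" "y \<in> {..<2 * k}"
  then show "(place k (r + s * int x) = place k (r + s * int y)) = (x = y)"
    using offset_place_nat[OF assms, of x r] offset_place_nat[OF assms, of y r] xy
    by (metis lessThan_iff)
next
  fix x show "place k (r + s * int x) \<in> pverts (middle_graph (cycle_graph k))"
    using assms by (simp add: pverts_middle_cycle)
next
  fix v assume "v \<in> pverts (middle_graph (cycle_graph k))"
  then show "\<exists>x\<in>{..<2 * k}. v = place k (r + s * int x)"
    using ex_place_nat[OF assms, of v r] by auto
qed

lemma sum_offset: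
  assumes "k \<ge> 3" "s = 1 \<or> s = -1"
  shows "(\<Sum>v\<in>pverts (middle_graph (cycle_graph k)). f (offset k r s v)) = (\<Sum>p<2 * k. f p)"
proof -
  have "(\<Sum>v\<in>pverts (middle_graph (cycle_graph k)). f (offset k r s v))
      = (\<Sum>p<2 * k. f (offset k r s (place k (r + s * int p))))"
    by (rule sum.reindex_bij_betw[OF bij_betw_place[OF assms], symmetric])
  then show ?thesis using offset_place_nat[OF assms] by simp
qed

lemma card_pverts_middle_cycle: "k \<ge> 3 \<Longrightarrow> card (pverts (middle_graph (cycle_graph k))) = 2 * k"
  by (metis bij_betw_same_card[OF bij_betw_place] card_lessThan)

text \<open>The two directions together run once around the circle. This tells which of two mirrored
  half weights covers a vertex.\<close>

lemma offset_reflect: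
  assumes "k \<ge> 3" "v \<in> pverts (middle_graph (cycle_graph k))" "v \<noteq> place k r"
  shows "0 < offset k r 1 v" "offset k r 1 v + offset k r (-1) v = 2 * k"
proof -
  obtain p where p: "p < 2 * k" "v = place k (r + int p)"
    using ex_place_nat[of k 1 v r] assms by auto
  have "p \<noteq> 0" using p assms(3) by (cases p) auto
  have "offset k r 1 v = p" using offset_place_nat[of k 1 p r] p assms by simp
  moreover have "offset k r (-1) v = 2 * k - p"
  proof -
    have "v = place k (r + -1 * int (2 * k - p))"
      unfolding p(2) place_eq_iff[OF assms(1)] using p(1)
      by (simp add: of_nat_diff mod_eq_dvd_iff)
    then show ?thesis using offset_place_nat[of k "-1" "2 * k - p" r] p \<open>p \<noteq> 0\<close> assms by simp
  qed
  ultimately show "0 < offset k r 1 v" "offset k r 1 v + offset k r (-1) v = 2 * k"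
    using p(1) \<open>p \<noteq> 0\<close> by auto
qed

section \<open>Upper bound for multiple pebbling\<close>

text \<open>
  The weight of the strategy that runs along one half of the circle towards the root at position
  \<open>r\<close>. The edge vertices form the path, the original vertices are leaves attached to it, and the
  antipode of the root is shared with the mirrored strategy.
\<close>

definition half_weight :: "nat \<Rightarrow> int \<Rightarrow> nat \<Rightarrow> nat" where
  "half_weight m r p =
     (if p = 0 then 2 ^ (m + 1) else if p = 2 * m then 1 else if p > 2 * m then 0
      else if odd (r + int p) then 2 ^ (m + 1 - (p + 1) div 2) else 2)"

text \<open>The parent of an edge vertex lies two positions nearer to the root, that of an original
  vertex is the edge vertex just before it; position 1 goes straight to the root.\<close>

lemma half_weight_parent:
  assumes "m \<ge> 1" "0 < p" "p \<le> 2 * m"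
  shows "\<exists>q<p. 2 * half_weight m r p \<le> half_weight m r q \<and>
    (p = q + 1 \<or> odd (r + int p) \<and> p = q + 2)"
proof -
  have pow: "2 * 2 ^ (m + 1 - Suc j) = (2 :: nat) ^ (m + 1 - j)" if "j \<le> m" for j
    using that by (simp add: Suc_diff_le)
  have four: "4 \<le> (2 :: nat) ^ (m + 1 - j)" if "j + 1 \<le> m" for j
    using power_increasing[of 2 "m + 1 - j" "2 :: nat"] that by simp
  have two: "2 \<le> (2 :: nat) ^ (m + 1 - j)" if "j \<le> m" for j
    using power_increasing[of 1 "m + 1 - j" "2 :: nat"] that by simp
  consider "p = 1" | "p \<ge> 2" "odd (r + int p)" | "p \<ge> 2" "even (r + int p)" using assms by linarith
  then show ?thesis
  proof cases
    case 1
    then have "2 * half_weight m r p \<le> half_weight m r 0"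
      using assms pow[of 0] four[of 0] two[of 0] by (auto simp: half_weight_def)
    then show ?thesis using 1 by (intro exI[of _ 0]) simp
  next
    case 2
    define q where "q = p - 2"
    have q: "p = q + 2" using 2 q_def by simp
    have "odd (r + int q)" using 2 q by simp
    moreover have "(p + 1) div 2 = Suc ((q + 1) div 2)" "(q + 1) div 2 \<le> m" using q assms by auto
    ultimately have "2 * half_weight m r p \<le> half_weight m r q"
      using 2 q assms pow[of "(q + 1) div 2"] two[of "(q + 1) div 2"] pow[of 0] two[of 0]
      by (auto simp: half_weight_def)
    then show ?thesis using 2 q by (intro exI[of _ q]) simp
  next
    case 3
    define q where "q = p - 1"
    have q: "p = q + 1" "q > 0" "q < 2 * m" using 3 q_def assms by auto
    have "odd (r + int q)" using 3 q by simp
    moreover have "p = 2 * m \<or> (q + 1) div 2 + 1 \<le> m" "(q + 1) div 2 \<le> m" using q by auto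
    ultimately have "2 * half_weight m r p \<le> half_weight m r q"
      using 3 q assms four[of "(q + 1) div 2"] two[of "(q + 1) div 2"]
      by (auto simp: half_weight_def)
    then show ?thesis using q by (intro exI[of _ q]) simp
  qed
qed

text \<open>Whatever the parity of \<open>r\<close>, positions \<open>2 * j + 1\<close> and
  \<open>2 * j + 2\<close> hold one edge vertex of weight \<open>2 ^ (m - j)\<close> and one
  original vertex of weight 2, which gives a geometric sum. Only the last pair differs: it contains
  the antipode of weight 1 and sums to 3.\<close>

lemma sum_half_weight:
  assumes "m \<ge> 1"
  shows "(\<Sum>p=1..<4 * m. half_weight m r p) = 2 ^ (m + 1) + 2 * m - 3"
proof -
  have S: "(\<Sum>p=1..2 * j. half_weight m r p) + 2 ^ (m + 1 - j) = 2 ^ (m + 1) + 2 * j" if "j < m" for j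
    using that
  proof (induction j)
    case 0
    then show ?case by simp
  next
    case (Suc j)
    have "half_weight m r (2 * j + 1) + half_weight m r (2 * j + 2) = 2 ^ (m - j) + 2"
      using Suc.prems by (auto simp: half_weight_def)
    moreover have "(2 :: nat) ^ (m + 1 - j) = 2 ^ (m - j) + 2 ^ (m - j)"
      using Suc.prems by (simp add: Suc_diff_le)
    ultimately show ?case using Suc by simp
  qed
  obtain j where m: "m = Suc j" using assms by (cases m) auto
  have last: "half_weight m r (2 * j + 1) + half_weight m r (2 * j + 2) = 3"
    by (auto simp: half_weight_def m)
  have "(\<Sum>p=1..<4 * m. half_weight m r p) = (\<Sum>p=1..2 * m. half_weight m r p)"
    using assms by (intro sum.mono_neutral_right) (auto simp: half_weight_def)
  also have "\<dots> = (\<Sum>p=1..2 * j. half_weight m r p) + 3" using last by (simp add: m)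
  finally show ?thesis using S[of j] by (simp add: m)
qed

text \<open>If both mirrored strategies fail, each weighted sum of pebbles is at most
  \<open>?c + t * 2 ^ (m + 1)\<close>. Jointly they give every vertex weight at least 2, so the
  number of pebbles obeys the same bound.\<close>

lemma reaches_middle_cycle:
  fixes m t :: nat
  defines "G \<equiv> middle_graph (cycle_graph (2 * m))"
  assumes m: "m \<ge> 2" and a: "a \<in> pverts G"
    and big: "2 ^ (m + 1) + 2 * m - 3 + t * 2 ^ (m + 1) < (\<Sum>v\<in>pverts G. D v)"
  shows "reaches G D a (Suc t)"
proof (rule ccontr)
  assume neg: "\<not> reaches G D a (Suc t)"
  let ?k = "2 * m"
  let ?V = "pverts G"
  let ?c = "2 ^ (m + 1) + 2 * m - 3 :: nat"
  have k: "?k \<ge> 3" using m by simp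
  interpret pair_graph G unfolding G_def by (rule pair_graph_middle_cycle[OF k])
  obtain r where r: "a = place ?k r" using a k by (auto simp: G_def pverts_middle_cycle)
  define w where "w s v = half_weight m r (offset ?k r s v)" for s v
  have bound: "(\<Sum>v\<in>?V. w s v * D v) \<le> ?c + t * 2 ^ (m + 1)" if s: "s = 1 \<or> s = -1" for s
  proof (rule ccontr)
    assume gt: "\<not> ?thesis"
    have wa: "w s a = 2 ^ (m + 1)"
      using offset_place_nat[OF k s, of 0 r] m by (simp add: w_def r half_weight_def)
    have "(\<Sum>v\<in>?V. w s v) = (\<Sum>p<2 * ?k. half_weight m r p)"
      unfolding w_def G_def by (rule sum_offset[OF k s])
    also have "\<dots> = half_weight m r 0 + (\<Sum>p=1..<4 * m. half_weight m r p)"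
      using m by (simp add: lessThan_atLeast0 sum.atLeast_Suc_lessThan)
    also have "\<dots> = 2 ^ (m + 1) + ?c" using sum_half_weight[of m r] m by (simp add: half_weight_def)
    finally have "(\<Sum>v\<in>?V - {a}. w s v) = ?c"
      using sum.remove[of ?V a "w s"] a wa by simp
    moreover have "\<exists>u\<in>?V. (v, u) \<in> parcs G \<and> 2 * w s v \<le> w s u"
      if v: "v \<in> ?V" "v \<noteq> a" "w s v > 0" for v
    proof -
      obtain p where p: "p < 2 * ?k" "v = place ?k (r + s * int p)"
        using ex_place_nat[OF k s, of v r] v(1) by (auto simp: G_def)
      have wp: "w s (place ?k (r + s * int q)) = half_weight m r q" if "q < 2 * ?k" for q
        unfolding w_def using offset_place_nat[OF k s that] by simp
      have "p \<noteq> 0" using p v(2) r by (cases p) auto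
      moreover have "p \<le> 2 * m" using v(3) wp[OF p(1)] p(2) by (auto simp: half_weight_def split: if_splits)
      ultimately obtain q where q: "q < p" "2 * half_weight m r p \<le> half_weight m r q"
        "p = q + 1 \<or> odd (r + int p) \<and> p = q + 2"
        using half_weight_parent[of m p r] m by auto
      let ?u = "place ?k (r + s * int q)"
      have "(v, ?u) \<in> parcs G"
        unfolding G_def parcs_middle_cycle[OF k]
        using p(2) q(3) s by (intro exI[of _ "r + s * int p"] exI[of _ "r + s * int q"]) auto
      moreover have "2 * w s v \<le> w s ?u" using wp[of p] wp[of q] p q by simp
      moreover have "?u \<in> ?V" using k by (simp add: G_def pverts_middle_cycle)
      ultimately show ?thesis by blast
    qed
    ultimately have "reaches G D a (Suc t)"
      using gt wa a by (intro reaches_of_weight[where w = "w s"]) auto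
    then show False using neg by simp
  qed
  \<comment> \<open>Away from the root and its antipode, one direction meets \<open>v\<close> before
    position \<open>2 * m\<close>, with weight at least 2. At the antipode both directions
    contribute 1.\<close>
  have "2 \<le> w 1 v + w (-1) v" if v: "v \<in> ?V" for v
  proof (cases "v = a")
    case True
    then have "w 1 v = 2 * 2 ^ m"
      using offset_place_nat[OF k, of 1 0 r] m by (simp add: w_def r half_weight_def)
    moreover have "2 \<le> 2 * (2 :: nat) ^ m" by simp
    ultimately show ?thesis by linarith
  next
    case False
    let ?p = "offset ?k r 1 v" and ?q = "offset ?k r (-1) v"
    have pq: "0 < ?p" "?p + ?q = 4 * m"
      using offset_reflect[OF k, of v r] v False r by (auto simp: G_def)
    have two: "2 \<le> half_weight m r i" if "0 < i" "i < 2 * m" for i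
      using that power_increasing[of 1 "m + 1 - (i + 1) div 2" "2 :: nat"] by (auto simp: half_weight_def)
    consider "?p < 2 * m" | "?p = 2 * m" "?q = 2 * m" | "?q < 2 * m" using pq by linarith
    then show ?thesis
    proof cases
      case 1
      then show ?thesis using two[of ?p] pq by (simp add: w_def)
    next
      case 2
      then show ?thesis using m by (simp add: w_def half_weight_def)
    next
      case 3
      have "?p < 2 * ?k"
        unfolding offset_def using m by (simp add: nat_less_iff)
      then show ?thesis using 3 two[of ?q] pq by (simp add: w_def)
    qed
  qed
  then have "(\<Sum>v\<in>?V. 2 * D v) \<le> (\<Sum>v\<in>?V. (w 1 v + w (-1) v) * D v)"
    by (intro sum_mono mult_le_mono1)
  also have "\<dots> = (\<Sum>v\<in>?V. w 1 v * D v) + (\<Sum>v\<in>?V. w (-1) v * D v)"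
    by (simp add: distrib_right sum.distrib)
  also have "\<dots> \<le> 2 * (?c + t * 2 ^ (m + 1))" using add_mono[OF bound[of 1] bound[of "-1"]] by simp
  finally show False using big by (simp add: sum_distrib_left[symmetric])
qed

section \<open>Lower bound\<close>

text \<open>
  For \<open>0 < p < 4n\<close>, the distance from position \<open>0\<close> to the edge vertex at position \<open>p\<close> if \<open>p\<close> is odd,
  and to the nearest edge vertex adjacent to position \<open>p\<close> if \<open>p\<close> is even.
\<close>

definition edge_dist :: "nat \<Rightarrow> nat \<Rightarrow> nat" where
  "edge_dist n p = min ((p + 1) div 2) ((4 * n - p + 1) div 2)"

lemma edge_dist_even: "edge_dist n (2 * a) = min a (2 * n - a)"
  by (simp add: edge_dist_def)

lemma edge_dist_odd: "a < 2 * n \<Longrightarrow> edge_dist n (2 * a + 1) = min (a + 1) (2 * n - a)"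
  by (simp add: edge_dist_def)

text \<open>These are the arc conditions of \<open>not_can_pebble_of_potential\<close> for the
  coefficients \<open>2 ^ (n - edge_dist n p)\<close>, where \<open>S\<close> consists of the
  nonzero even positions.\<close>

lemma edge_dist_adjacent:
  assumes n: "n \<ge> 2" and pq: "\<bar>p - q\<bar> = 1 \<or> odd p \<and> \<bar>p - q\<bar> = 2"
  defines "p' \<equiv> nat (p mod (4 * int n))" and "q' \<equiv> nat (q mod (4 * int n))"
  shows "even p' \<and> p' \<noteq> 0 \<Longrightarrow> odd q' \<and> edge_dist n p' \<le> edge_dist n q'"
    and "odd p' \<or> p' = 0 \<Longrightarrow> edge_dist n p' \<le> edge_dist n q' + 1"
proof -
  define d where "d = q - p"
  have d: "d \<in> {-2, -1, 1, 2}" "\<bar>d\<bar> = 2 \<Longrightarrow> odd p" using pq d_def by auto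
  have p': "int p' = p mod (4 * int n)" "p' < 4 * n" using n by (auto simp: p'_def nat_less_iff)
  have par: "even p' \<longleftrightarrow> even p"
    by (metis p'(1) dvd_mod_iff dvd_mult2 even_numeral even_of_nat)
  have q: "int q' = (int p' + d) mod (4 * int n)"
    using n by (simp add: p' q'_def d_def mod_simps)
  \<comment> \<open>Position 0 is even, so no step of length 2 starts there and a backward step
    overshoots by at most one.\<close>
  have lo: "int p' + d \<ge> -1"
    using d par by (cases "p' = 0") auto
  have hi: "int p' + d \<le> 4 * int n + 1" using d p'(2) by auto
  consider "int p' + d = -1" | "0 \<le> int p' + d" "int p' + d < 4 * int n"
    | "int p' + d = 4 * int n" | "int p' + d = 4 * int n + 1" using lo hi by linarith
  then have qq: "(int p' + d = -1 \<and> q' = 4 * n - 1) \<or> int q' = int p' + d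
      \<or> (int p' + d = 4 * int n \<and> q' = 0) \<or> (int p' + d = 4 * int n + 1 \<and> q' = 1)"
  proof cases
    case 1
    have "(- 1 :: int) mod (4 * int n) = 4 * int n - 1" using n by (simp add: zmod_minus1)
    then show ?thesis using 1 q n by auto
  next
    case 4
    have "(4 * int n + 1) mod (4 * int n) = 1" using n by (simp add: mod_simps)
    then show ?thesis using 4 q by auto
  qed (use q in auto)
  have q'l: "q' < 4 * n" using n by (auto simp: q'_def nat_less_iff)
  show "odd q' \<and> edge_dist n p' \<le> edge_dist n q'" if ev: "even p' \<and> p' \<noteq> 0"
  proof -
    obtain a where a: "p' = 2 * a" using ev by (elim conjE evenE)
    have "a > 0" "a < 2 * n" using a ev p'(2) by auto
    have "d = 1 \<or> d = -1" using d par ev by auto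
    then have "int p' + d = int (2 * a + 1) \<or> int p' + d = int (2 * (a - 1) + 1)"
      "0 \<le> int p' + d" "int p' + d < 4 * int n"
      using a \<open>a > 0\<close> \<open>a < 2 * n\<close> by (auto simp: of_nat_diff)
    then have "q' = 2 * a + 1 \<or> q' = 2 * (a - 1) + 1" using q by (metis mod_pos_pos_trivial of_nat_eq_iff)
    then show ?thesis
      using edge_dist_odd[of a n] edge_dist_odd[of "a - 1" n] \<open>a > 0\<close> \<open>a < 2 * n\<close>
      unfolding a edge_dist_even by auto
  qed
  show "edge_dist n p' \<le> edge_dist n q' + 1" if od: "odd p' \<or> p' = 0"
  proof (cases "p' = 0")
    case True
    then show ?thesis by (simp add: edge_dist_def)
  next
    case False
    then obtain a where a: "p' = 2 * a + 1" using od by (auto elim: oddE)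
    have an: "a < 2 * n" using a p'(2) by simp
    consider "d = 1" | "d = -1" | "d = 2" | "d = -2" using d by auto
    \<comment> \<open>The alternatives \<open>a + 1 = 2 * n\<close> and \<open>a = 0\<close> are the
      edge vertices next to position 0; their \<open>edge_dist\<close> is 1, so the bound holds
      whatever \<open>q'\<close> is.\<close>
    then consider "q' = 2 * (a + 1)" | "a + 1 = 2 * n" | "q' = 2 * a" | "a = 0"
      | "q' = 2 * (a + 1) + 1" "a + 1 < 2 * n" | "q' = 2 * (a - 1) + 1" "a > 0"
      using qq a an q'l by cases (auto; linarith)+
    then show ?thesis
    proof cases
      case 5
      then show ?thesis using edge_dist_odd[of "a + 1" n] edge_dist_odd[of a n] an by (simp add: a)
    next
      case 6
      then show ?thesis using edge_dist_odd[of "a - 1" n] edge_dist_odd[of a n] an by (simp add: a)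
    qed (use edge_dist_odd[of a n] edge_dist_even[of n "a + 1"] edge_dist_even[of n a] an a in \<open>auto simp: min_def\<close>)
  qed
qed

text \<open>The upper bound with \<open>t = 0\<close> supplies a number of pebbles that always
  suffices, so the \<open>LEAST\<close> is attained.\<close>

lemma can_pebble_middle_cycle:
  fixes n :: nat
  defines "G \<equiv> middle_graph (cycle_graph (2 * n))"
  assumes n: "n \<ge> 2" and a: "a \<in> pverts G" and "pebbling_number G \<le> (\<Sum>v\<in>pverts G. D v)"
  shows "can_pebble G D a"
proof -
  interpret pair_graph G unfolding G_def using n by (intro pair_graph_middle_cycle) simp
  have "E \<in> distributions G (2 ^ (n + 1) + 2 * n) \<Longrightarrow> can_pebble G E a" for E
    using reaches_middle_cycle[of n a 0 E] n a
    by (simp add: can_pebble_iff_reaches distributions_def G_def)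
  moreover have "vertex_pebbling_number G a \<le> pebbling_number G"
    unfolding pebbling_number_def using a by (intro Max_ge) auto
  then have "vertex_pebbling_number G a \<le> (\<Sum>v\<in>pverts G. D v)" using assms(4) by (rule order_trans)
  ultimately show ?thesis by (rule can_pebble_of_vertex_pebbling_number[OF pair_finite_verts])
qed

text \<open>Were the pebbling number smaller, the \<open>2 ^ (n + 1) + 2 * n - 3\<close> pebbles of
  \<open>D\<close> would suffice for position 0; a potential shows that they do not.\<close>

lemma pebbling_number_middle_cycle_ge:
  fixes n :: nat
  defines "G \<equiv> middle_graph (cycle_graph (2 * n))"
  assumes n: "n \<ge> 2"
  shows "2 ^ (n + 1) + 2 * n - 2 \<le> pebbling_number G"
proof (rule ccontr)
  assume less: "\<not> ?thesis"
  let ?k = "2 * n" and ?V = "pverts G"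
  have k: "?k \<ge> 3" using n by simp
  define pos where "pos = offset ?k 0 1"
  have pos_place: "pos (place ?k p) = nat (p mod (4 * int n))" for p
    using offset_place[OF k, of 0 1 p] by (simp add: pos_def)
  have sum_by_pos: "(\<Sum>v\<in>?V. f (pos v)) = (\<Sum>p<4 * n. f p)" for f :: "nat \<Rightarrow> nat"
    using sum_offset[OF k, of 1 f 0] by (simp add: pos_def G_def)
  define d :: "nat \<Rightarrow> nat" where
    "d p = (if p = 2 * n then 2 ^ (n + 1) - 1 else if even p \<and> p \<noteq> 0 then 1 else 0)" for p
  define D where "D v = d (pos v)" for v
  define c where "c v = (2 :: nat) ^ (n - edge_dist n (pos v))" for v
  define S where "S = {v. even (pos v) \<and> pos v \<noteq> 0}"
  let ?a = "place ?k 0"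
  have a: "?a \<in> ?V" "pos ?a = 0" using n pos_place[of 0] by (auto simp: G_def pverts_middle_cycle)
  have evens: "(\<Sum>p<2 * j. if even p then 1 else 0) = j" for j :: nat
    by (induction j) auto
  have "(1 :: nat) \<le> 2 ^ n" by simp
  then have "2 * 2 ^ n - Suc 0 = Suc (2 * 2 ^ n - 2)" by linarith
  \<comment> \<open>One pebble on each even position is the reference: the root lacks its pebble and
    the antipode has \<open>2 ^ (n + 1) - 2\<close> extra ones.\<close>
  then have "(\<Sum>p<4 * n. d p) + (\<Sum>p<4 * n. if p = 0 then 1 else 0)
      = (\<Sum>p<4 * n. if p = 2 * n then 2 ^ (n + 1) - 2 else 0) + (\<Sum>p<4 * n. if even p then 1 else 0)"
    unfolding sum.distrib[symmetric] using n by (intro sum.cong) (auto simp: d_def)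
  then have "(\<Sum>p<4 * n. d p) + 1 = 2 ^ (n + 1) - 2 + 2 * n"
    using n evens[of "2 * n"] by simp
  then have "(\<Sum>v\<in>?V. D v) + 1 = 2 ^ (n + 1) - 2 + 2 * n"
    unfolding D_def sum_by_pos .
  moreover have "(2 :: nat) \<le> 2 ^ (n + 1)" by simp
  ultimately have "pebbling_number G \<le> (\<Sum>v\<in>?V. D v)" using less by linarith
  then have "can_pebble G D ?a" using can_pebble_middle_cycle[of n ?a D] n a by (simp add: G_def)
  moreover have "\<not> can_pebble G D ?a"
  proof (rule not_can_pebble_of_potential[where c = c and S = S])
    show "pair_graph G" unfolding G_def by (rule pair_graph_middle_cycle[OF k])
    show "?a \<in> ?V" "?a \<notin> S" using a by (auto simp: S_def)
    fix u v assume "(u, v) \<in> parcs G"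
    then obtain p q where pq: "u = place ?k p" "v = place ?k q"
      "\<bar>p - q\<bar> = 1 \<or> odd p \<and> \<bar>p - q\<bar> = 2"
      unfolding G_def parcs_middle_cycle[OF k] by blast
    note adj = edge_dist_adjacent[OF n pq(3), folded pos_place, folded pq(1,2)]
    show "c v \<le> 2 * c u" if "u \<notin> S"
    proof -
      have "edge_dist n (pos u) \<le> edge_dist n (pos v) + 1" using adj(2) that by (auto simp: S_def)
      then have "n - edge_dist n (pos v) \<le> Suc (n - edge_dist n (pos u))" by linarith
      then have "(2 :: nat) ^ (n - edge_dist n (pos v)) \<le> 2 ^ Suc (n - edge_dist n (pos u))"
        by (rule power_increasing) simp
      then show ?thesis by (simp add: c_def)
    qed
    show "v \<notin> S \<and> c v \<le> c u" if "u \<in> S"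
      using adj(1) that by (auto simp: S_def c_def intro!: power_increasing)
  next
    have "(\<Sum>x\<in>?V. c x * (if x \<in> S then D x div 2 else D x))
        = (\<Sum>p<4 * n. 2 ^ (n - edge_dist n p) * (if even p \<and> p \<noteq> 0 then d p div 2 else d p))"
      unfolding c_def D_def S_def mem_Collect_eq
      by (rule sum_by_pos[of "\<lambda>p. 2 ^ (n - edge_dist n p) * (if even p \<and> p \<noteq> 0 then d p div 2 else d p)"])
    \<comment> \<open>Single pebbles form no pair, and the antipode has coefficient 1 and
      \<open>2 ^ n - 1\<close> pairs: one less than the \<open>2 ^ n\<close> required at the
      root.\<close>
    also have "\<dots> = (\<Sum>p<4 * n. if p = 2 * n then 2 ^ n - 1 else 0)"
      using n by (intro sum.cong) (auto simp: d_def edge_dist_even)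
    also have "\<dots> < c ?a" using n a by (simp add: c_def edge_dist_def)
    finally show "(\<Sum>x\<in>?V. c x * (if x \<in> S then D x div 2 else D x)) < c ?a" .
  qed
  ultimately show False by simp
qed

section \<open>The product of two middle graphs\<close>

text \<open>On the left stands the waste of all columns. On the right, the lower bound for the
  longer cycle is multiplied by \<open>2 * m - 2\<close>, the excess of the lower bound for the
  shorter one over the price \<open>2 ^ (m + 1)\<close>.\<close>

lemma middle_cycle_arithmetic:
  fixes m n :: nat
  assumes "m \<ge> 5" "n \<ge> m + 2"
  shows "4 * n * (2 ^ (m + 1) + 2 * m - 3) \<le> (2 ^ (n + 1) + 2 * n - 2) * (2 * m - 2)"
  using assms(2)
proof (induction n rule: dec_induct)
  case base
  \<comment> \<open>For \<open>m = 5\<close> this reads 60 \<le> 64; it is the growth that the base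
    case \<open>n = m + 2\<close> relies on.\<close>
  have Q: "12 * m \<le> 2 ^ (m + 1)" using assms(1) by (induction m rule: dec_induct) auto
  obtain a where a: "m = a + 5" using assms(1) by (metis le_Suc_ex add.commute)
  obtain q where q: "2 ^ (m + 1) = 12 * m + q" using Q by (metis le_Suc_ex)
  have "(2 :: nat) ^ (m + 2 + 1) = 4 * 2 ^ (m + 1)" by simp
  then have "(2 :: nat) ^ (m + 2 + 1) = 4 * (12 * m + q)" using q by simp
  then show ?case unfolding q by (simp add: a algebra_simps)
next
  case (step n)
  have "(2 :: nat) ^ (m + 3) \<le> 2 ^ (n + 1)" using step.hyps by (intro power_increasing) auto
  then have P: "4 * 2 ^ (m + 1) \<le> (2 :: nat) ^ (n + 1)" by (simp add: power_add)
  \<comment> \<open>Compares the increments of both sides from \<open>n\<close> to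
    \<open>n + 1\<close>, with \<open>2 ^ (n + 1)\<close> replaced by its lower bound
    \<open>4 * 2 ^ (m + 1)\<close>.\<close>
  have "4 * (2 ^ (m + 1) + 2 * m - 3) \<le> (4 * 2 ^ (m + 1) + 2) * (2 * m - 2)"
  proof -
    have "4 * (2 ^ (m + 1) + 2 * m - 3) \<le> 4 * (2 ^ (m + 1) + 2 * m :: nat)" by simp
    also have "\<dots> \<le> (4 * 2 ^ (m + 1) + 2) * 8"
      using less_exp[of m] by (simp, linarith)
    also have "\<dots> \<le> (4 * 2 ^ (m + 1) + 2) * (2 * m - 2)" using assms(1) by (intro mult_le_mono2) simp
    finally show ?thesis .
  qed
  also have "\<dots> \<le> (2 ^ (n + 1) + 2) * (2 * m - 2)" using P by (intro mult_le_mono1) auto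
  finally have "4 * n * (2 ^ (m + 1) + 2 * m - 3) + 4 * (2 ^ (m + 1) + 2 * m - 3)
      \<le> (2 ^ (n + 1) + 2 * n - 2) * (2 * m - 2) + (2 ^ (n + 1) + 2) * (2 * m - 2)"
    using step.IH by (rule add_mono[rotated])
  also have "\<dots> = (2 ^ (n + 1) + 2 * n - 2 + (2 ^ (n + 1) + 2)) * (2 * m - 2)"
    by (simp only: distrib_right)
  also have "2 ^ (n + 1) + 2 * n - 2 + (2 ^ (n + 1) + 2) = 2 ^ (Suc n + 1) + 2 * Suc n - (2 :: nat)"
    using step.hyps by simp
  finally show ?case by (simp add: algebra_simps)
qed

text \<open>The shorter cycle provides the columns and the longer one the row, whose large pebbling
  number absorbs the waste of the columns.\<close>

lemma can_pebble_product_middle_cycles: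
  fixes m n :: nat
  defines "G \<equiv> middle_graph (cycle_graph (2 * n))" and "H \<equiv> middle_graph (cycle_graph (2 * m))"
  assumes m: "m \<ge> 5" and n: "n \<ge> m + 2" and rs: "r \<in> pverts G" "s \<in> pverts H"
    and D: "D \<in> distributions (cartesian_product G H) (pebbling_number G * pebbling_number H)"
  shows "can_pebble (cartesian_product G H) D (r, s)"
proof -
  let ?c = "2 ^ (m + 1) + 2 * m - 3 :: nat" and ?W = "2 ^ (m + 1) :: nat"
  interpret G: pair_graph G unfolding G_def using m n by (intro pair_graph_middle_cycle) simp
  interpret H: pair_graph H unfolding H_def using m by (intro pair_graph_middle_cycle) simp
  have "card (pverts G) * ?c \<le> (2 ^ (n + 1) + 2 * n - 2) * (2 * m - 2)"
    using middle_cycle_arithmetic[OF m n] card_pverts_middle_cycle[of "2 * n"] m n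
    by (simp add: G_def)
  also have "\<dots> \<le> pebbling_number G * (2 * m - 2)"
    using pebbling_number_middle_cycle_ge[of n] m n by (intro mult_le_mono1) (simp add: G_def)
  finally have "card (pverts G) * ?c + ?W * pebbling_number G \<le> pebbling_number G * (2 * m - 2 + ?W)"
    by (simp add: distrib_left mult.commute)
  also have "\<dots> \<le> pebbling_number G * pebbling_number H"
    using pebbling_number_middle_cycle_ge[of m] m by (intro mult_le_mono2) (simp add: H_def)
  finally have N: "card (pverts G) * ?c + ?W * pebbling_number G \<le> pebbling_number G * pebbling_number H" .
  show ?thesis
  proof (rule can_pebble_cartesian_product[OF G.pair_finite_verts rs(2) _ _ _ N D])
    fix E :: "nat + nat set \<Rightarrow> nat" and t
    assume "?c + t * ?W < (\<Sum>y\<in>pverts H. E y)"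
    then show "reaches H E s (Suc t)"
      using reaches_middle_cycle[of m s t E] m rs by (simp add: H_def)
  next
    fix E :: "nat + nat set \<Rightarrow> nat"
    assume "pebbling_number G \<le> (\<Sum>x\<in>pverts G. E x)"
    then show "can_pebble G E r" using can_pebble_middle_cycle[of n r E] m n rs by (simp add: G_def)
  qed simp
qed

theorem theorem2p8:
  fixes m n :: nat
  assumes "m \<ge> 5" and "n \<ge> 5"
    and "\<bar>int n - int m\<bar> \<ge> 2"
  shows "pebbling_number
           (cartesian_product (middle_graph (cycle_graph (2 * n))) (middle_graph (cycle_graph (2 * m))))
         \<le> pebbling_number (middle_graph (cycle_graph (2 * n))) *
            pebbling_number (middle_graph (cycle_graph (2 * m)))"
proof -
  let ?G = "middle_graph (cycle_graph (2 * n))" and ?H = "middle_graph (cycle_graph (2 * m))"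
  let ?P = "cartesian_product ?G ?H"
  let ?N = "pebbling_number ?G * pebbling_number ?H"
  have PG: "pair_graph ?G" and PH: "pair_graph ?H"
    using assms by (auto intro!: pair_graph_middle_cycle)
  interpret P: pair_graph ?P by (rule pair_graph_cartesian_product[OF PG PH])
  have solve: "can_pebble ?P D (r, s)"
    if "r \<in> pverts ?G" "s \<in> pverts ?H" "D \<in> distributions ?P ?N" for r s D
  proof (cases "n \<ge> m + 2")
    case True
    then show ?thesis using can_pebble_product_middle_cycles[of m n r s D] assms(1) that by simp
  next
    \<comment> \<open>Now the second factor has the longer cycle, so the factors are
      exchanged.\<close>
    case False
    then have "m \<ge> n + 2" using assms(3) by linarith
    then show ?thesis
      using can_pebble_product_middle_cycles[of n m s r] assms(2) that
      by (intro can_pebble_cartesian_product_swap[of ?H ?G ?N]) (auto simp: mult.commute)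
  qed
  have "vertex_pebbling_number ?P z \<le> ?N" if "z \<in> pverts ?P" for z
    unfolding vertex_pebbling_number_def
    by (rule Least_le) (use that solve in \<open>auto simp: cartesian_product_def\<close>)
  moreover have "pverts ?P \<noteq> {}"
    using assms by (simp add: cartesian_product_def pverts_middle_cycle)
  ultimately show ?thesis unfolding pebbling_number_def[of ?P] by (intro Max.boundedI) auto
qed

end
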